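(* Let $a$ be a positive integer and let $p$ be a prime with $p\geq 3a+3$. Then $$\sum_{i=1}^{p-1}i^{-a}\left(H_i^{(a)}\right)^2\equiv\sum_{i=1}^{p-1}i^{-2a}H_i^{(a)}\equiv-\sum_{i=1}^{p-1}i^{-a}H_i^{(2a)},$$ where both congruences hold modulo $p$ if $a$ is even, and modulo $p^2$ if $a$ is odd.
   Context: For an integer $r$ and a positive integer $n$, $H_n^{(r)}=\sum_{k=1}^n k^{-r}$ is the generalized harmonic number. Congruences are between rational numbers whose denominators are not divisible by $p$: $\frac mn\equiv\frac rs \pmod{p^k}$ means $ms\equiv nr\pmod{p^k}$, where $n,s$ are not divisible by $p$. *)

theory Defs
  imports Complex_Main "HOL-Number_Theory.Number_Theory"
begin

definition gen_harm :: "int \<Rightarrow> nat \<Rightarrow> rat" where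
  "gen_harm r n = (\<Sum>k=1..n. (of_nat k :: rat) powi (- r))"

text \<open>
  Congruence of \<open>p\<close>-integral rationals modulo \<open>p ^ k\<close>. The relation holds only if both sides
  can be written with denominators not divisible by \<open>p\<close> (in particular, nonzero); for prime \<open>p\<close>
  the congruence does not depend on the choice of such representations.
\<close>

definition rat_cong :: "nat \<Rightarrow> nat \<Rightarrow> rat \<Rightarrow> rat \<Rightarrow> bool" where
  "rat_cong p k x y \<longleftrightarrow>
     (\<exists>m n r s :: int.
        x = of_int m / of_int n \<and> y = of_int r / of_int s \<and>
        \<not> int p dvd n \<and> \<not> int p dvd s \<and>
        [m * s = n * r] (mod (int p ^ k)))"

end

theory Submission
  imports Defs
begin

text \<open>
  Write \<open>P b\<close> for the sum of \<open>i^(-b)\<close> over \<open>1 \<le> i \<le> p - 1\<close>, and \<open>S\<^sub>1\<close>, \<open>S\<^sub>2\<close>, \<open>S\<^sub>3\<close> for the sums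
  of \<open>i^(-a) (H a i)\<^sup>2\<close>, \<open>i^(-2a) H a i\<close> and \<open>i^(-a) H (2 a) i\<close> over the same range, where
  \<open>H\<close> is the generalized harmonic number.  Two exact identities
  reduce the theorem to congruences for \<open>P\<close>.
  Telescoping the cubes of the partial sums gives \<open>3 (S\<^sub>1 - S\<^sub>2) = (P a)^3 - P (3 a)\<close>
  (\<open>cube_of_sum_via_partial_sums\<close>), and exchanging the two summations over \<open>k \<le> i\<close> gives
  \<open>S\<^sub>2 + S\<^sub>3 = P a * P (2 a) + P (3 a)\<close> (\<open>sum_partial_sums_swap\<close>).

  Since \<open>3 a < p - 1\<close>, every power sum here is divisible by \<open>p\<close> (\<open>inverse_power_sum_mod_p\<close>), which
  settles even \<open>a\<close>.  If \<open>a\<close> is odd, so is \<open>3 a\<close>, and pairing \<open>i\<close> with \<open>p - i\<close> shows that \<open>P b\<close> is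
  divisible by \<open>p\<^sup>2\<close> for odd \<open>b\<close> with \<open>b + 1 < p - 1\<close> (\<open>inverse_power_sum_mod_p2\<close>); the products of
  two or more power sums are divisible by \<open>p\<^sup>2\<close> in any case.  The bound \<open>p \<ge> 3 a + 3\<close> is what
  the exponent \<open>3 a + 1\<close> requires, and it also makes \<open>3\<close> invertible modulo \<open>p\<close>.
\<close>

section \<open>Powers of the maximal ideal of the localization at a prime\<close>

text \<open>
  For prime \<open>p\<close> this is the ideal generated by \<open>p ^ k\<close> in the ring of \<open>p\<close>-integral rationals,
  viewed as a set of rationals; \<open>k = 0\<close> gives the ring itself.
\<close>
definition ploc :: "nat \<Rightarrow> nat \<Rightarrow> rat set" where
  "ploc p k = {of_int (int p ^ k * m) / of_int n |m n. \<not> int p dvd n}"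

lemma plocI: "x = of_int (int p ^ k * m) / of_int n \<Longrightarrow> \<not> int p dvd n \<Longrightarrow> x \<in> ploc p k"
  unfolding ploc_def by blast

lemma plocE:
  assumes "x \<in> ploc p k"
  obtains m n where "x = of_int (int p ^ k * m) / of_int n" "\<not> int p dvd n" "n \<noteq> 0"
proof -
  obtain m n where x: "x = of_int (int p ^ k * m) / of_int n" "\<not> int p dvd n"
    using assms unfolding ploc_def by blast
  have "n \<noteq> 0" using x(2) by (metis dvd_0_right)
  with x show thesis by (rule that)
qed

lemma ploc_divide: "int p ^ k dvd m \<Longrightarrow> \<not> int p dvd n \<Longrightarrow> of_int m / of_int n \<in> ploc p k"
  by (elim dvdE) (auto intro: plocI)

lemma ploc_zero: "prime p \<Longrightarrow> 0 \<in> ploc p k"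
  by (rule plocI[where m = 0 and n = 1]) auto

lemma ploc_mult:
  assumes "prime p" "x \<in> ploc p j" "y \<in> ploc p k"
  shows "x * y \<in> ploc p (j + k)"
proof -
  obtain m n where x: "x = of_int (int p ^ j * m) / of_int n" "\<not> int p dvd n"
    using assms(2) by (rule plocE)
  obtain r s where y: "y = of_int (int p ^ k * r) / of_int s" "\<not> int p dvd s"
    using assms(3) by (rule plocE)
  show ?thesis
  proof (rule plocI)
    show "x * y = of_int (int p ^ (j + k) * (m * r)) / of_int (n * s)"
      by (simp add: x y power_add)
    show "\<not> int p dvd n * s"
      using x y assms(1) by (simp add: prime_dvd_mult_iff)
  qed
qed

lemma ploc_add:
  assumes "prime p" "x \<in> ploc p k" "y \<in> ploc p k"
  shows "x + y \<in> ploc p k"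
proof -
  obtain m n where x: "x = of_int (int p ^ k * m) / of_int n" "\<not> int p dvd n" "n \<noteq> 0"
    using assms(2) by (rule plocE)
  obtain r s where y: "y = of_int (int p ^ k * r) / of_int s" "\<not> int p dvd s" "s \<noteq> 0"
    using assms(3) by (rule plocE)
  show ?thesis
  proof (rule plocI)
    show "x + y = of_int (int p ^ k * (m * s + r * n)) / of_int (n * s)"
      using x y by (simp add: field_simps)
    show "\<not> int p dvd n * s"
      using x y assms(1) by (simp add: prime_dvd_mult_iff)
  qed
qed

lemma ploc_uminus: "x \<in> ploc p k \<Longrightarrow> - x \<in> ploc p k"
  by (erule plocE, rule plocI[where m = "- m" and n = n for m n]) auto

lemma ploc_diff:
  assumes "prime p" "x \<in> ploc p k" "y \<in> ploc p k"
  shows "x - y \<in> ploc p k"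
  using ploc_add[OF assms(1,2) ploc_uminus[OF assms(3)]] by simp

lemma ploc_sum:
  assumes "prime p" "\<And>i. i \<in> A \<Longrightarrow> f i \<in> ploc p k"
  shows "(\<Sum>i\<in>A. f i) \<in> ploc p k"
  using assms(2) by (induction A rule: infinite_finite_induct) (auto simp: assms(1) ploc_zero ploc_add)

lemma ploc_mono:
  assumes "x \<in> ploc p k" "j \<le> k"
  shows "x \<in> ploc p j"
  using assms(1)
proof (rule plocE)
  fix m n assume "x = of_int (int p ^ k * m) / of_int n" "\<not> int p dvd n"
  thus ?thesis
    using assms(2) by (auto intro!: ploc_divide dvd_mult2 le_imp_power_dvd simp del: of_int_mult)
qed

lemma ploc_cancel:
  assumes "of_int c * x \<in> ploc p k" "prime p" "\<not> int p dvd c"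
  shows "x \<in> ploc p k"
  using assms(1)
proof (rule plocE)
  fix m n assume *: "of_int c * x = of_int (int p ^ k * m) / of_int n" "\<not> int p dvd n" "n \<noteq> 0"
  have "c \<noteq> 0" using assms(3) by auto
  with * have "x = of_int (int p ^ k * m) / of_int (c * n)"
    by (simp add: field_simps)
  moreover have "\<not> int p dvd c * n"
    using * assms by (simp add: prime_dvd_mult_iff)
  ultimately show ?thesis by (rule plocI)
qed

lemma rat_cong_of_diff:
  assumes "prime p" "x \<in> ploc p 0" "y \<in> ploc p 0" "x - y \<in> ploc p k"
  shows "rat_cong p k x y"
proof -
  obtain m n where x: "x = of_int m / of_int n" "\<not> int p dvd n" "n \<noteq> 0"
    using plocE[OF assms(2)] by auto
  obtain r s where y: "y = of_int r / of_int s" "\<not> int p dvd s" "s \<noteq> 0"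
    using plocE[OF assms(3)] by auto
  obtain t u where d: "x - y = of_int (int p ^ k * t) / of_int u" "\<not> int p dvd u" "u \<noteq> 0"
    using assms(4) by (rule plocE)
  have "(of_int ((m * s - n * r) * u) :: rat) = of_int (int p ^ k * t * (n * s))"
    using d x y by (simp add: field_simps)
  hence "(m * s - n * r) * u = int p ^ k * t * (n * s)"
    by (simp only: of_int_eq_iff)
  hence "int p ^ k dvd (m * s - n * r) * u" by simp
  moreover have "coprime (int p ^ k) u"
    using assms(1) d(2) by (simp add: prime_imp_coprime)
  ultimately have "int p ^ k dvd m * s - n * r"
    by (simp add: coprime_dvd_mult_left_iff)
  hence "[m * s = n * r] (mod (int p ^ k))"
    by (simp add: cong_iff_dvd_diff)
  with x y show ?thesis
    unfolding rat_cong_def by blast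
qed

section \<open>Power sums with negative exponents\<close>

text \<open>
  Telescoping \<open>(i + 1)^(m + 1) - i^(m + 1)\<close> over \<open>i < p\<close> expresses \<open>m + 1\<close> times the \<open>m\<close>-th
  power sum through \<open>p^(m + 1)\<close> and the lower power sums, so induction applies as long as \<open>m + 1\<close>
  is invertible.  The start of the induction is \<open>m = 0\<close>, where \<open>0 ^ 0 = 1\<close> makes the sum equal
  to \<open>p\<close>.
\<close>
lemma prime_dvd_power_sum:
  assumes "prime p" "m + 1 < p"
  shows "int p dvd (\<Sum>i<p. int i ^ m)"
  using assms(2)
proof (induction m rule: less_induct)
  case (less m)
  have tele: "(\<Sum>i<p. int (Suc i) ^ Suc m - int i ^ Suc m) = int p ^ Suc m"
    by (subst sum_lessThan_telescope) simp
  have step: "int (Suc i) ^ Suc m - int i ^ Suc m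
      = (\<Sum>j<m. int (Suc m choose j) * int i ^ j) + int (Suc m) * int i ^ m" for i
  proof -
    have "int (Suc i) ^ Suc m = (\<Sum>j\<le>Suc m. int (Suc m choose j) * int i ^ j)"
      using binomial_ring[of "int i" 1 "Suc m"] by (simp add: add.commute)
    also have "\<dots> = (\<Sum>j<m. int (Suc m choose j) * int i ^ j)
        + int (Suc m) * int i ^ m + int i ^ Suc m"
      by (simp only: lessThan_Suc_atMost[symmetric] sum.lessThan_Suc) simp
    finally show ?thesis by simp
  qed
  have "int p ^ Suc m = (\<Sum>j<m. int (Suc m choose j) * (\<Sum>i<p. int i ^ j))
      + int (Suc m) * (\<Sum>i<p. int i ^ m)"
    unfolding tele[symmetric] step sum.distrib sum_distrib_left by (subst sum.swap) simp
  moreover have "int p dvd (\<Sum>j<m. int (Suc m choose j) * (\<Sum>i<p. int i ^ j))"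
  proof (rule dvd_sum)
    fix j assume "j \<in> {..<m}"
    thus "int p dvd int (Suc m choose j) * (\<Sum>i<p. int i ^ j)"
      using less.prems by (intro dvd_mult less.IH) simp_all
  qed
  moreover have "int p dvd int p ^ Suc m" by simp
  ultimately have "int p dvd int (Suc m) * (\<Sum>i<p. int i ^ m)"
    by (simp only: dvd_add_right_iff)
  moreover have "\<not> int p dvd int (Suc m)"
    using less.prems by (auto simp del: of_nat_Suc dest!: dvd_imp_le)
  ultimately show ?case
    using assms(1) prime_dvd_mult_iff[of "int p" "int (Suc m)"] by simp
qed

lemma not_dvd_small:
  assumes "i \<in> {1..p - 1}"
  shows "\<not> int p dvd int i"
  using assms by (auto dest!: dvd_imp_le)

lemma inverse_power_in_ploc:
  assumes "prime p" "i \<in> {1..p - 1}"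
  shows "inverse (of_nat i) ^ b \<in> ploc p 0"
proof -
  have "\<not> int p dvd int i ^ b"
    using not_dvd_small[OF assms(2)] assms(1) by (metis prime_dvd_power prime_nat_int_transfer)
  thus ?thesis
    using ploc_divide[of p 0 1 "int i ^ b"]
    by (simp only: power_inverse) (simp add: inverse_eq_divide)
qed

text \<open>
  Fermat's little theorem replaces the exponent \<open>- b\<close> by \<open>p - 1 - b\<close>, which is positive, so the
  index \<open>i = 0\<close> contributes nothing to the power sum used.
\<close>
lemma inverse_power_sum_mod_p:
  assumes "prime p" "0 < b" "b + 1 < p"
  shows "(\<Sum>i=1..p-1. inverse (of_nat i :: rat) ^ b) \<in> ploc p 1"
proof -
  let ?c = "p - 1 - b"
  have p: "p > 1" using assms by simp
  have "(\<Sum>i<p. int i ^ ?c) = (\<Sum>i=1..p-1. int i ^ ?c)"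
    using assms by (intro sum.mono_neutral_right) (auto simp: Suc_le_eq)
  hence "int p dvd (\<Sum>i=1..p-1. int i ^ ?c)"
    using prime_dvd_power_sum[of p ?c] assms by simp
  hence A: "of_int (\<Sum>i=1..p-1. int i ^ ?c) \<in> ploc p 1"
    using ploc_divide[of p 1 "\<Sum>i=1..p-1. int i ^ ?c" 1] p by (simp del: of_int_sum)
  have B: "inverse (of_nat i) ^ b - of_int (int i ^ ?c) \<in> ploc p 1" if i: "i \<in> {1..p-1}" for i
  proof -
    have nd: "\<not> p dvd i" using not_dvd_small[OF i] by simp
    have "[i ^ (p - 1) = 1] (mod p)"
      using fermat_theorem[OF assms(1) nd] .
    hence "[int i ^ (p - 1) = 1] (mod int p)"
      by (metis cong_int_iff of_nat_1 of_nat_power)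
    hence "int p ^ 1 dvd 1 - int i ^ (p - 1)"
      by (simp add: cong_iff_dvd_diff dvd_diff_commute)
    moreover have "\<not> int p dvd int i ^ b"
      using not_dvd_small[OF i] assms(1) by (metis prime_dvd_power prime_nat_int_transfer)
    ultimately have "of_int (1 - int i ^ (p - 1)) / of_int (int i ^ b) \<in> ploc p 1"
      by (rule ploc_divide)
    moreover have "int i ^ (p - 1) = int i ^ ?c * int i ^ b"
      using assms by (simp add: power_add[symmetric])
    moreover have "of_int (1 - int i ^ ?c * int i ^ b) / of_int (int i ^ b)
        = inverse (of_nat i) ^ b - (of_int (int i ^ ?c) :: rat)"
      using i by (simp add: field_simps)
    ultimately show ?thesis by (simp only:)
  qed
  have "(\<Sum>i=1..p-1. inverse (of_nat i :: rat) ^ b) =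
      (\<Sum>i=1..p-1. inverse (of_nat i) ^ b - of_int (int i ^ ?c)) + of_int (\<Sum>i=1..p-1. int i ^ ?c)"
    by (simp add: sum_subtractf)
  also have "\<dots> \<in> ploc p 1"
    by (rule ploc_add[OF assms(1) ploc_sum[OF assms(1) B] A])
  finally show ?thesis .
qed

lemma power_add_mod_square:
  fixes x d :: int
  shows "\<exists>t. (x + d) ^ Suc n = x ^ Suc n + int (Suc n) * d * x ^ n + d\<^sup>2 * t"
proof (induction n)
  case 0
  show ?case by (intro exI[of _ 0]) simp
next
  case (Suc n)
  then obtain t where "(x + d) ^ Suc n = x ^ Suc n + int (Suc n) * d * x ^ n + d\<^sup>2 * t" ..
  hence "(x + d) ^ Suc (Suc n) =
      (x + d) * (x ^ Suc n + int (Suc n) * d * x ^ n + d\<^sup>2 * t)" by simp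
  also have "\<dots> = x ^ Suc (Suc n) + int (Suc (Suc n)) * d * x ^ Suc n
      + d\<^sup>2 * (int (Suc n) * x ^ n + (x + d) * t)"
    by (simp add: algebra_simps power2_eq_square)
  finally show ?case by blast
qed

text \<open>
  Expanding \<open>(p - i)^b\<close> to first order in \<open>p\<close>: for odd \<open>b\<close> the leading terms of \<open>i^(-b)\<close> and
  \<open>(p - i)^(-b)\<close> cancel, and the linear term is a multiple of \<open>i^(-b-1)\<close>.
\<close>
lemma paired_inverse_powers:
  assumes "prime p" "odd b" "i \<in> {1..p - 1}"
  shows "inverse (of_nat i :: rat) ^ b + inverse (of_nat (p - i)) ^ b
          + of_nat p * of_nat b * inverse (of_nat i) ^ (b + 1) \<in> ploc p 2"
proof -
  obtain n where b: "b = Suc n" and n: "even n" using assms(2) by (cases b) auto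
  define u v where "u = int i" and "v = int (p - i)"
  have v: "v = - u + int p" using assms(3) by (auto simp: u_def v_def)
  obtain t where "v ^ Suc n = (- u) ^ Suc n + int (Suc n) * int p * (- u) ^ n + (int p)\<^sup>2 * t"
    unfolding v using power_add_mod_square by blast
  hence t: "v ^ b = - (u * u ^ n) + int b * int p * u ^ n + (int p)\<^sup>2 * t"
    using n by (simp add: b)
  have "u * v ^ b + u * u ^ b + int p * int b * v ^ b
      = (int p)\<^sup>2 * (u * t + int b * int b * u ^ n + int p * int b * t)"
    unfolding t by (simp add: b algebra_simps power2_eq_square)
  hence num: "int p ^ 2 dvd u * v ^ b + u * u ^ b + int p * int b * v ^ b" by simp
  have "\<not> int p dvd u" "\<not> int p dvd v"
    unfolding u_def v_def using assms(3) by (intro not_dvd_small; force)+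
  hence "\<not> int p dvd u ^ (b + 1) * v ^ b"
    using assms(1) by (metis prime_dvd_mult_iff prime_dvd_power prime_nat_int_transfer)
  with num have "of_int (u * v ^ b + u * u ^ b + int p * int b * v ^ b)
      / of_int (u ^ (b + 1) * v ^ b) \<in> ploc p 2"
    by (rule ploc_divide)
  moreover have "u \<noteq> 0" "v \<noteq> 0" using assms(3) by (auto simp: u_def v_def)
  moreover have "(of_nat i :: rat) = of_int u" "(of_nat (p - i) :: rat) = of_int v"
    by (simp_all add: u_def v_def)
  ultimately show ?thesis
    by (simp add: field_simps)
qed

text \<open>
  By the reflection \<open>i \<mapsto> p - i\<close>, twice the sum is \<open>- p b\<close> times the power sum of exponent
  \<open>b + 1\<close> modulo \<open>p\<^sup>2\<close>, and that sum contributes a second factor \<open>p\<close>.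
\<close>
lemma inverse_power_sum_mod_p2:
  assumes "prime p" "odd b" "b + 2 < p"
  shows "(\<Sum>i=1..p-1. inverse (of_nat i :: rat) ^ b) \<in> ploc p 2"
proof -
  let ?P = "\<lambda>b. \<Sum>i=1..p-1. inverse (of_nat i :: rat) ^ b"
  have refl: "(\<Sum>i=1..p-1. inverse (of_nat (p - i) :: rat) ^ b) = ?P b"
    by (rule sum.reindex_bij_witness[of _ "\<lambda>i. p - i" "\<lambda>i. p - i"]) auto
  have "(\<Sum>i=1..p-1. inverse (of_nat i :: rat) ^ b + inverse (of_nat (p - i)) ^ b
          + of_nat p * of_nat b * inverse (of_nat i) ^ (b + 1)) \<in> ploc p 2"
    using paired_inverse_powers[OF assms(1,2)] by (rule ploc_sum[OF assms(1)])
  hence A: "2 * ?P b + of_nat p * of_nat b * ?P (b + 1) \<in> ploc p 2"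
    unfolding sum.distrib refl sum_distrib_left[symmetric] by simp
  have "of_nat p * of_nat b \<in> ploc p 1"
    using ploc_divide[of p 1 "int p * int b" 1] assms(3) by simp
  from ploc_mult[OF assms(1) this inverse_power_sum_mod_p[of p "b + 1"]]
  have B: "of_nat p * of_nat b * ?P (b + 1) \<in> ploc p 2"
    using assms by (simp add: numeral_2_eq_2)
  have "of_int 2 * ?P b \<in> ploc p 2"
    using ploc_diff[OF assms(1) A B] by simp
  moreover have "\<not> int p dvd 2"
    using assms(2,3) by (auto dest: zdvd_imp_le elim: oddE)
  ultimately show ?thesis
    using assms(1) ploc_cancel by blast
qed

section \<open>Identities for partial sums\<close>

lemma cube_of_sum_via_partial_sums:
  fixes x :: "nat \<Rightarrow> 'a :: comm_ring_1"
  shows "(\<Sum>i=1..n. x i) ^ 3 =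
    3 * (\<Sum>i=1..n. x i * (\<Sum>k=1..i. x k)\<^sup>2) - 3 * (\<Sum>i=1..n. x i ^ 2 * (\<Sum>k=1..i. x k))
    + (\<Sum>i=1..n. x i ^ 3)"
  by (induction n) (simp_all add: algebra_simps power2_eq_square power3_eq_cube)

lemma sum_partial_sums_swap:
  fixes x y :: "nat \<Rightarrow> 'a :: comm_ring_1"
  shows "(\<Sum>i=1..n. y i * (\<Sum>k=1..i. x k)) + (\<Sum>i=1..n. x i * (\<Sum>k=1..i. y k)) =
    (\<Sum>i=1..n. x i) * (\<Sum>i=1..n. y i) + (\<Sum>i=1..n. x i * y i)"
  by (induction n) (simp_all add: algebra_simps)

section \<open>The congruences\<close>

theorem mainTheorem3:
  fixes a p :: nat
  assumes "a > 0" and "prime p" and "p \<ge> 3 * a + 3"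
  defines "e \<equiv> (if even a then 1 else 2 :: nat)"
  shows "rat_cong p e
           (\<Sum>i=1..p-1. (of_nat i :: rat) powi (- int a) * (gen_harm (int a) i)\<^sup>2)
           (\<Sum>i=1..p-1. (of_nat i :: rat) powi (- (2 * int a)) * gen_harm (int a) i)
       \<and> rat_cong p e
           (\<Sum>i=1..p-1. (of_nat i :: rat) powi (- (2 * int a)) * gen_harm (int a) i)
           (- (\<Sum>i=1..p-1. (of_nat i :: rat) powi (- int a) * gen_harm (2 * int a) i))"
proof -
  define x :: "nat \<Rightarrow> rat" where "x i = inverse (of_nat i) ^ a" for i
  have x1: "(of_nat i :: rat) powi (- int a) = x i" for i
    by (simp add: x_def power_int_minus power_inverse)
  have x2: "(of_nat i :: rat) powi (- (2 * int a)) = x i ^ 2" for i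
  proof -
    have "(of_nat i :: rat) powi (- (2 * int a)) = (of_nat i :: rat) powi (- int (a * 2))"
      by (simp add: mult.commute)
    also have "\<dots> = x i ^ 2"
      by (simp only: x_def power_int_minus power_int_of_nat power_inverse power_mult)
    finally show ?thesis .
  qed
  have h1: "gen_harm (int a) i = (\<Sum>k=1..i. x k)" for i
    by (simp add: gen_harm_def x1)
  have h2: "gen_harm (2 * int a) i = (\<Sum>k=1..i. x k ^ 2)" for i
    by (simp only: gen_harm_def x2)
  define S1 where "S1 = (\<Sum>i=1..p-1. x i * (\<Sum>k=1..i. x k)\<^sup>2)"
  define S2 where "S2 = (\<Sum>i=1..p-1. x i ^ 2 * (\<Sum>k=1..i. x k))"
  define S3 where "S3 = (\<Sum>i=1..p-1. x i * (\<Sum>k=1..i. x k ^ 2))"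
  define P where "P j = (\<Sum>i=1..p-1. x i ^ j)" for j
  note pp = assms(2)
  have mult0: "y * z \<in> ploc p 0" if "y \<in> ploc p 0" "z \<in> ploc p 0" for y z
    using ploc_mult[OF pp that] by simp
  have X: "x i \<in> ploc p 0" if "i \<in> {1..p - 1}" for i
    unfolding x_def using inverse_power_in_ploc[OF pp that] .
  have H: "(\<Sum>k=1..i. x k) \<in> ploc p 0" "(\<Sum>k=1..i. x k ^ 2) \<in> ploc p 0"
    if "i \<in> {1..p - 1}" for i
    using that by (auto intro!: ploc_sum[OF pp] X mult0 simp: power2_eq_square)
  have int: "S1 \<in> ploc p 0" "S2 \<in> ploc p 0" "- S3 \<in> ploc p 0"
    unfolding S1_def S2_def S3_def power2_eq_square
    by (intro ploc_uminus ploc_sum[OF pp] mult0 X H[unfolded power2_eq_square]; assumption)+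

  have Pj: "P j = (\<Sum>i=1..p-1. inverse (of_nat i) ^ (a * j))" for j
    by (simp add: P_def x_def power_mult)
  have P1: "P 1 \<in> ploc p 1" and P2: "P 2 \<in> ploc p 1"
    unfolding Pj using assms by (intro inverse_power_sum_mod_p; simp)+
  have P3: "P 3 \<in> ploc p e"
    unfolding Pj e_def using assms inverse_power_sum_mod_p[of p "a * 3"]
      inverse_power_sum_mod_p2[of p "a * 3"] by simp
  have e: "e \<le> 2" by (simp add: e_def)
  have P12: "P 1 * P 2 \<in> ploc p e" and P11: "P 1 * P 1 \<in> ploc p e"
    using ploc_mult[OF pp P1 P2] ploc_mult[OF pp P1 P1] e
    by (auto intro: ploc_mono)
  have P111: "P 1 ^ 3 \<in> ploc p e"
    using ploc_mult[OF pp P11 ploc_mono[OF P1, of 0]] by (simp add: power3_eq_cube)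

  have "P 1 ^ 3 = 3 * S1 - 3 * S2 + P 3"
    using cube_of_sum_via_partial_sums[of x "p - 1"] by (simp add: P_def S1_def S2_def)
  hence "of_int 3 * (S1 - S2) = P 1 ^ 3 - P 3" by (simp add: algebra_simps)
  hence "of_int 3 * (S1 - S2) \<in> ploc p e"
    using ploc_diff[OF pp P111 P3] by simp
  moreover have "\<not> int p dvd 3"
    using assms(1,3) by (auto dest: zdvd_imp_le)
  ultimately have D1: "S1 - S2 \<in> ploc p e"
    using ploc_cancel pp by blast

  have "S2 + S3 = P 1 * P 2 + P 3"
    using sum_partial_sums_swap[of "\<lambda>i. x i ^ 2" x "p - 1"]
    by (simp add: P_def S2_def S3_def power2_eq_square power3_eq_cube mult.assoc)
  hence D2: "S2 - (- S3) \<in> ploc p e"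
    using ploc_add[OF pp P12 P3] by simp

  show ?thesis
    unfolding x1 x2 h1 h2 S1_def[symmetric] S2_def[symmetric] S3_def[symmetric]
    using rat_cong_of_diff[OF pp int(1,2) D1] rat_cong_of_diff[OF pp int(2,3) D2] by simp
qed

end
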